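(* Let $X$ and $Y$ be connected graphs of bounded degree, let $m,n\geq 1$ be integers and let $\kappa=m/n$. Let $f:X\to Y$ be a quasi-isometry that is quasi-$\kappa$-to-one. Then there exists a surjective $m$-to-one map $g: X\times \mathbb{Z}/n\mathbb{Z}\to Y$ (i.e. $|g^{-1}(y)|=m$ for every $y\in Y$) such that $f$ lies at bounded distance from $g\circ j$, where $j:X\to X\times\mathbb{Z}/n\mathbb{Z}$, $x\mapsto (x,0)$, is the canonical injection; that is, $\sup_{x\in X} d(f(x),g(j(x)))<\infty$.
   Context: Graphs are identified with their vertex sets, equipped with the graph (path) metric. For a set $A$ of vertices of $Y$, $\partial A$ denotes the set of vertices not in $A$ that are adjacent to a vertex of $A$. A map $f:X\to Y$ between metric spaces is a quasi-isometry if there are $C\geq 1$, $K\geq 0$ with $\frac1C d(x,y)-K\leq d(f(x),f(y))\leq C d(x,y)+K$ for all $x,y\in X$ and every point of $Y$ is within distance $K$ of $f(X)$. For $\kappa>0$, a map $f:X\to Y$ between bounded degree graphs is quasi-$\kappa$-to-one if there is a constant $C>0$ such that $\big|\kappa|A|-|f^{-1}(A)|\big|\leq C|\partial A|$ for all finite $A\subset Y$. *)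

theory Defs
  imports Complex_Main "HOL-Library.FuncSet" "HOL-Algebra.Elementary_Groups"
begin

text \<open>
  A graph is given by its vertex set \<open>V\<close> and its adjacency relation \<open>E\<close>.
\<close>

definition simple_graph :: "'a set \<Rightarrow> 'a rel \<Rightarrow> bool" where
  "simple_graph V E \<longleftrightarrow> E \<subseteq> V \<times> V \<and> sym E \<and> irrefl E"

definition connected_graph :: "'a set \<Rightarrow> 'a rel \<Rightarrow> bool" where
  "connected_graph V E \<longleftrightarrow> (\<forall>x\<in>V. \<forall>y\<in>V. (x, y) \<in> E\<^sup>*)"

definition bounded_degree :: "'a set \<Rightarrow> 'a rel \<Rightarrow> bool" where
  "bounded_degree V E \<longleftrightarrow> (\<exists>D::nat. \<forall>v\<in>V. finite (E `` {v}) \<and> card (E `` {v}) \<le> D)"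

text \<open>
  The path metric. The value is meaningful only for vertices joined by some path,
  hence for all pairs of vertices of a connected graph.
\<close>

definition path_dist :: "'a rel \<Rightarrow> 'a \<Rightarrow> 'a \<Rightarrow> real" where
  "path_dist E x y = real (LEAST k. (x, y) \<in> E ^^ k)"

definition vertex_boundary :: "'a set \<Rightarrow> 'a rel \<Rightarrow> 'a set \<Rightarrow> 'a set" where
  "vertex_boundary V E A = {v \<in> V. v \<notin> A \<and> (\<exists>a\<in>A. (a, v) \<in> E)}"

definition quasi_isometry ::
    "'a set \<Rightarrow> ('a \<Rightarrow> 'a \<Rightarrow> real) \<Rightarrow> 'b set \<Rightarrow> ('b \<Rightarrow> 'b \<Rightarrow> real) \<Rightarrow> ('a \<Rightarrow> 'b) \<Rightarrow> bool" where
  "quasi_isometry X dX Y dY f \<longleftrightarrow>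
     f \<in> X \<rightarrow> Y \<and>
     (\<exists>C K. C \<ge> 1 \<and> K \<ge> 0 \<and>
        (\<forall>x\<in>X. \<forall>x'\<in>X. 1 / C * dX x x' - K \<le> dY (f x) (f x') \<and>
                       dY (f x) (f x') \<le> C * dX x x' + K) \<and>
        (\<forall>y\<in>Y. \<exists>x\<in>X. dY y (f x) \<le> K))"

text \<open>
  Finiteness of the preimages is stated explicitly because \<^const>\<open>card\<close> is \<open>0\<close> on
  infinite sets, whereas the intended inequality fails for an infinite preimage.
\<close>

definition quasi_to_one ::
    "real \<Rightarrow> 'a set \<Rightarrow> 'b set \<Rightarrow> 'b rel \<Rightarrow> ('a \<Rightarrow> 'b) \<Rightarrow> bool" where
  "quasi_to_one \<kappa> X Y E f \<longleftrightarrow>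
     f \<in> X \<rightarrow> Y \<and>
     (\<exists>C>0. \<forall>A. finite A \<and> A \<subseteq> Y \<longrightarrow>
        finite (f -` A \<inter> X) \<and>
        \<bar>\<kappa> * real (card A) - real (card (f -` A \<inter> X))\<bar>
          \<le> C * real (card (vertex_boundary Y E A)))"

end

theory Submission
  imports Defs
begin

text \<open>
  Let \<open>Z\<close> be \<open>\<int>/n\<int>\<close> and write \<open>N\<^sub>r A\<close> for the set of vertices at distance at most \<open>r\<close> from \<open>A\<close>.
  An \<open>m\<close>-to-one map on \<open>X \<times> Z\<close> is the first component of a bijection
  \<open>X \<times> Z \<rightarrow> Y \<times> {..<m}\<close>. It stays close to \<open>f\<close> if, for some fixed \<open>R\<close>, the bijection is a perfect
  matching in the bipartite graph that joins \<open>(x, i)\<close> to \<open>(y, j)\<close> when \<open>f x\<close> and \<open>y\<close> have distance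
  at most \<open>R\<close>. This graph is locally finite, so Hall's condition on both sides yields two
  injections along edges, and the Cantor-Bernstein construction merges them into a perfect
  matching (\<open>perfect_matching_locally_finite\<close>). What remains is to choose \<open>R\<close> such that,
  for all finite \<open>A \<subseteq> Y\<close>,
  \<open>\<kappa> |A| \<le> |f\<^sup>-\<^sup>1 (N\<^sub>R A)|\<close> and \<open>|f\<^sup>-\<^sup>1 A| \<le> \<kappa> |N\<^sub>R A|\<close> (\<open>fibre_counts_balanced\<close>).

  The difficulty is that the error term \<open>C |\<partial>A|\<close> cannot be absorbed directly: \<open>A\<close> may have many
  one-point holes, so that \<open>N\<^sub>R A\<close> exceeds \<open>A\<close> by little more than \<open>\<partial>A\<close>. The remedy is to apply the
  hypothesis to \<open>N\<^sub>r A\<close> at a well chosen \<open>r < R\<close>. Cut \<open>N\<^sub>R A - A\<close> into many annuli of a fixed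
  width; by the pigeonhole principle one of them contains only a small share of the points
  (\<open>thin_step\<close>). If \<open>r\<close> is its middle radius, the error \<open>C |\<partial> (N\<^sub>r A)|\<close> is at most \<open>C\<close> times the
  size of this annulus, and it is outweighed by the points of \<open>N\<^sub>R A - A\<close> inside and outside
  the annulus: on one side of \<open>r\<close> these points are counted by \<open>\<kappa>\<close> times the size of a neighbourhood, and on the
  other side they force many points of \<open>X\<close> into the preimage, because the image of a quasi-isometry is
  coarsely dense and balls of a given radius have bounded size (\<open>uniform_radius\<close>).
\<close>

section \<open>Matchings in infinite bipartite graphs\<close>

text \<open>
  Delete edges as long as Hall's condition survives. Local finiteness makes the condition stable
  under unions of chains of deletions, so a maximal set of deletions exists. In what is then
  left each \<open>i\<close> has a single neighbour: if it had two, \<open>p\<close> and \<open>q\<close>, deleting either edge would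
  violate the condition on finite sets \<open>J\<close> and \<open>K\<close> containing \<open>i\<close>, and counting neighbours of
  \<open>J \<union> K\<close> and \<open>J \<inter> K - {i}\<close> contradicts Hall's condition.
\<close>

lemma hall_marriage_locally_finite:
  fixes G :: "('i \<times> 'j) set"
  assumes fin: "\<And>i. i \<in> I \<Longrightarrow> finite (G `` {i})"
    and hall: "\<And>J. finite J \<Longrightarrow> J \<subseteq> I \<Longrightarrow> card J \<le> card (G `` J)"
  shows "\<exists>\<phi>. inj_on \<phi> I \<and> (\<forall>i\<in>I. (i, \<phi> i) \<in> G)"
proof -
  define \<D> where "\<D> = {D. \<forall>J. finite J \<and> J \<subseteq> I \<longrightarrow> card J \<le> card ((G - D) `` J)}"
  have finG: "finite (G `` J)" if "finite J" "J \<subseteq> I" for J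
  proof -
    have "G `` J = (\<Union>i\<in>J. G `` {i})" by blast
    then show ?thesis using that fin by auto
  qed
  have "\<exists>M\<in>\<D>. \<forall>D\<in>\<D>. M \<subseteq> D \<longrightarrow> D = M"
  proof (rule subset_Zorn')
    fix C assume C: "subset.chain \<D> C"
    show "\<Union>C \<in> \<D>"
    proof (cases "C = {}")
      case True
      then show ?thesis using hall by (simp add: \<D>_def)
    next
      case False
      have "card J \<le> card ((G - \<Union>C) `` J)" if J: "finite J" "J \<subseteq> I" for J
      proof -
        \<comment> \<open>Only finitely many deleted edges start in \<open>J\<close>, so one member of the chain has them all.\<close>
        let ?F = "G \<inter> (J \<times> UNIV) \<inter> \<Union>C"
        have "G \<inter> (J \<times> UNIV) \<subseteq> J \<times> G `` J" by blast
        then have "finite ?F"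
          using finG[OF J] J(1) by (meson finite_Int finite_SigmaI finite_subset)
        then obtain D where D: "D \<in> C" "?F \<subseteq> D"
          using finite_subset_Union_chain[OF _ _ False C, of ?F] by blast
        have "(G - D) `` J = (G - \<Union>C) `` J" using D by blast
        moreover have "D \<in> \<D>" using C D(1) by (auto simp: subset.chain_def)
        ultimately show ?thesis using J unfolding \<D>_def by auto
      qed
      then show ?thesis by (auto simp: \<D>_def)
    qed
  qed
  then obtain M where M: "M \<in> \<D>" and maxi: "\<And>D. D \<in> \<D> \<Longrightarrow> M \<subseteq> D \<Longrightarrow> D = M" by blast
  define H where "H = G - M"
  have hallH: "card J \<le> card (H `` J)" if "finite J" "J \<subseteq> I" for J
    using M that by (auto simp: \<D>_def H_def)
  have finH: "finite (H `` J)" if "finite J" "J \<subseteq> I" for J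
    using finG[OF that] by (rule rev_finite_subset) (auto simp: H_def)
  have tight: "\<exists>J. finite J \<and> J \<subseteq> I \<and> i \<in> J \<and> card ((H - {(i, p)}) `` J) < card J"
    if ip: "(i, p) \<in> H" for i p
  proof -
    have "insert (i, p) M \<notin> \<D>" using maxi[of "insert (i, p) M"] ip by (auto simp: H_def)
    then obtain J where J: "finite J" "J \<subseteq> I" "card ((G - insert (i, p) M) `` J) < card J"
      by (auto simp: \<D>_def not_le)
    have eq: "G - insert (i, p) M = H - {(i, p)}" by (auto simp: H_def)
    have "i \<in> J"
    proof (rule ccontr)
      assume "i \<notin> J"
      then have "(H - {(i, p)}) `` J = H `` J" by blast
      then show False using J hallH[of J] eq by simp
    qed
    then show ?thesis using J eq by auto
  qed
  have unique: "p = q" if i: "i \<in> I" and ip: "(i, p) \<in> H" and iq: "(i, q) \<in> H" for i p q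
  proof (rule ccontr)
    assume "p \<noteq> q"
    obtain J where J: "finite J" "J \<subseteq> I" "i \<in> J" "card ((H - {(i, p)}) `` J) < card J"
      using tight[OF ip] by blast
    obtain K where K: "finite K" "K \<subseteq> I" "i \<in> K" "card ((H - {(i, q)}) `` K) < card K"
      using tight[OF iq] by blast
    let ?S = "(H - {(i, p)}) `` J" and ?T = "(H - {(i, q)}) `` K"
    have fS: "finite ?S" by (rule finite_subset[OF _ finH[OF J(1,2)]]) blast
    have fT: "finite ?T" by (rule finite_subset[OF _ finH[OF K(1,2)]]) blast
    have "card (J \<union> K) \<le> card (H `` (J \<union> K))" using J K by (intro hallH) auto
    also have "\<dots> \<le> card (?S \<union> ?T)"
      using fS fT J(3) K(3) \<open>p \<noteq> q\<close> by (intro card_mono) blast+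
    finally have 1: "card (J \<union> K) \<le> card (?S \<union> ?T)" .
    have "card (J \<inter> K - {i}) \<le> card (H `` (J \<inter> K - {i}))" using J K by (intro hallH) auto
    also have "\<dots> \<le> card (?S \<inter> ?T)" using fS by (intro card_mono) blast+
    finally have 2: "card (J \<inter> K - {i}) \<le> card (?S \<inter> ?T)" .
    have 3: "card (J \<inter> K) = Suc (card (J \<inter> K - {i}))"
      using J K by (intro card.remove) auto
    show False
      using 1 2 3 J(4) K(4) card_Un_Int[OF fS fT] card_Un_Int[OF J(1) K(1)] by linarith
  qed
  have "\<exists>p. (i, p) \<in> H" if "i \<in> I" for i
  proof -
    have "H `` {i} \<noteq> {}" using hallH[of "{i}"] that by auto
    then show ?thesis by blast
  qed
  then obtain \<phi> where \<phi>: "\<And>i. i \<in> I \<Longrightarrow> (i, \<phi> i) \<in> H" by metis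
  have "inj_on \<phi> I"
  proof (rule inj_onI, rule ccontr)
    fix i j assume ij: "i \<in> I" "j \<in> I" "\<phi> i = \<phi> j" "i \<noteq> j"
    have "H `` {i, j} \<subseteq> {\<phi> i}"
      using unique[OF ij(1) \<phi>[OF ij(1)]] unique[OF ij(2) \<phi>[OF ij(2)]] ij(3) by auto
    then have "card (H `` {i, j}) \<le> 1" using card_mono[of "{\<phi> i}" "H `` {i, j}"] by simp
    then show False using hallH[of "{i, j}"] ij by simp
  qed
  then show ?thesis using \<phi> by (auto simp: H_def)
qed

text \<open>
  The usual construction, recording that the bijection only uses edges of the graphs
  of \<open>\<phi>\<close> and of \<open>\<psi>\<close>.
\<close>

lemma cantor_bernstein_within:
  assumes \<phi>: "inj_on \<phi> P" "\<phi> ` P \<subseteq> Q" and \<psi>: "inj_on \<psi> Q" "\<psi> ` Q \<subseteq> P"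
  shows "\<exists>h. bij_betw h P Q \<and> (\<forall>p\<in>P. h p = \<phi> p \<or> \<psi> (h p) = p)"
proof -
  \<comment> \<open>The set \<open>A\<close> on which to follow \<open>\<phi>\<close> is chosen such that \<open>\<psi>\<close> maps \<open>Q - \<phi> ` A\<close> onto \<open>P - A\<close>.\<close>
  define A where "A = lfp (\<lambda>S. P - \<psi> ` (Q - \<phi> ` S))"
  have "mono (\<lambda>S. P - \<psi> ` (Q - \<phi> ` S))" by (rule monoI) blast
  then have A: "A = P - \<psi> ` (Q - \<phi> ` A)" unfolding A_def by (rule lfp_unfold)
  have AP: "A \<subseteq> P" and co: "P - A = \<psi> ` (Q - \<phi> ` A)" using A \<psi>(2) by blast+
  define h where "h p = (if p \<in> A then \<phi> p else inv_into Q \<psi> p)" for p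
  have "bij_betw \<phi> A (\<phi> ` A)" using \<phi>(1) AP by (meson inj_on_imp_bij_betw inj_on_subset)
  then have 1: "bij_betw h A (\<phi> ` A)"
    by (rule bij_betw_cong[THEN iffD1, rotated]) (simp add: h_def)
  have "bij_betw \<psi> (Q - \<phi> ` A) (P - A)"
    using \<psi>(1) co by (metis Diff_subset inj_on_imp_bij_betw inj_on_subset)
  then have "bij_betw (inv_into Q \<psi>) (P - A) (Q - \<phi> ` A)"
    using \<psi>(1) by (metis Diff_subset bij_betw_inv_into_subset bij_betw_imp_surj_on bij_betw_subset inj_on_imp_bij_betw)
  then have 2: "bij_betw h (P - A) (Q - \<phi> ` A)"
    by (rule bij_betw_cong[THEN iffD1, rotated]) (simp add: h_def)
  have "bij_betw h (A \<union> (P - A)) (\<phi> ` A \<union> (Q - \<phi> ` A))"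
    using 1 2 by (rule bij_betw_combine) blast
  moreover have "A \<union> (P - A) = P" "\<phi> ` A \<union> (Q - \<phi> ` A) = Q" using AP \<phi>(2) by blast+
  ultimately have "bij_betw h P Q" by simp
  moreover have "h p = \<phi> p \<or> \<psi> (h p) = p" if "p \<in> P" for p
  proof (cases "p \<in> A")
    case False
    then have "p \<in> \<psi> ` Q" using that co by blast
    then show ?thesis using False by (simp add: h_def f_inv_into_f)
  qed (simp add: h_def)
  ultimately show ?thesis by blast
qed

lemma perfect_matching_locally_finite:
  fixes G :: "('p \<times> 'q) set"
  assumes G: "G \<subseteq> P \<times> Q"
    and finP: "\<And>p. p \<in> P \<Longrightarrow> finite (G `` {p})"
    and finQ: "\<And>q. q \<in> Q \<Longrightarrow> finite (G\<inverse> `` {q})"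
    and hallP: "\<And>J. finite J \<Longrightarrow> J \<subseteq> P \<Longrightarrow> card J \<le> card (G `` J)"
    and hallQ: "\<And>J. finite J \<Longrightarrow> J \<subseteq> Q \<Longrightarrow> card J \<le> card (G\<inverse> `` J)"
  shows "\<exists>h. bij_betw h P Q \<and> (\<forall>p\<in>P. (p, h p) \<in> G)"
proof -
  obtain \<phi> where \<phi>: "inj_on \<phi> P" "\<forall>p\<in>P. (p, \<phi> p) \<in> G"
    using hall_marriage_locally_finite[of P G] finP hallP by blast
  obtain \<psi> where \<psi>: "inj_on \<psi> Q" "\<forall>q\<in>Q. (q, \<psi> q) \<in> G\<inverse>"
    using hall_marriage_locally_finite[of Q "G\<inverse>"] finQ hallQ by blast
  have "\<phi> ` P \<subseteq> Q" "\<psi> ` Q \<subseteq> P" using \<phi> \<psi> G by auto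
  then obtain h where h: "bij_betw h P Q" "\<forall>p\<in>P. h p = \<phi> p \<or> \<psi> (h p) = p"
    using cantor_bernstein_within[OF \<phi>(1) _ \<psi>(1)] by blast
  have "(p, h p) \<in> G" if "p \<in> P" for p
  proof -
    have "h p \<in> Q" using h(1) that by (auto simp: bij_betw_def)
    then show ?thesis using h(2) that \<phi>(2) \<psi>(2) by force
  qed
  then show ?thesis using h(1) by blast
qed

section \<open>Thickenings of finite vertex sets\<close>

text \<open>
  The closed \<open>r\<close>-neighbourhood in the path metric. Walks that may pause give it directly as
  an image under a power of a relation, which turns the triangle inequality into
  \<open>thicken_add\<close>.
\<close>

definition thicken :: "'a rel \<Rightarrow> nat \<Rightarrow> 'a set \<Rightarrow> 'a set" where
  "thicken E r A = ((E\<^sup>=) ^^ r) `` A"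

lemma thicken_0 [simp]: "thicken E 0 A = A"
  by (simp add: thicken_def)

lemma thicken_Suc: "thicken E (Suc r) A = thicken E r A \<union> E `` thicken E r A"
  by (auto simp: thicken_def relcomp_Image)

lemma thicken_add: "thicken E (r + s) A = thicken E s (thicken E r A)"
  by (simp add: thicken_def relpow_add relcomp_Image)

lemma thicken_mono_radius: "r \<le> s \<Longrightarrow> thicken E r A \<subseteq> thicken E s A"
  by (rule lift_Suc_mono_le) (auto simp: thicken_Suc)

lemma thicken_mono: "A \<subseteq> B \<Longrightarrow> thicken E r A \<subseteq> thicken E r B"
  by (auto simp: thicken_def)

lemma thicken_subset:
  assumes "simple_graph V E" "A \<subseteq> V"
  shows "thicken E r A \<subseteq> V"
  using assms by (induction r) (auto simp: thicken_Suc simple_graph_def)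

lemma thicken_sym:
  assumes "simple_graph V E"
  shows "y \<in> thicken E r {x} \<longleftrightarrow> x \<in> thicken E r {y}"
proof -
  have "sym (E\<^sup>=)" using assms by (auto simp: simple_graph_def sym_def)
  then have conv: "(E\<^sup>=)\<inverse> = E\<^sup>=" by (simp only: sym_conv_converse_eq)
  have "sym ((E\<^sup>=) ^^ r)"
    unfolding sym_conv_converse_eq
  proof (induction r)
    case (Suc r)
    then show ?case by (metis conv converse_relcomp relpow.simps(2) relpow_commute)
  qed simp
  then show ?thesis by (metis Image_singleton_iff symD thicken_def)
qed

lemma finite_thicken:
  assumes "simple_graph V E" "bounded_degree V E" "finite A" "A \<subseteq> V"
  shows "finite (thicken E r A)"
proof (induction r)
  case (Suc r)
  have "E `` thicken E r A = (\<Union>v\<in>thicken E r A. E `` {v})" by blast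
  moreover have "finite (E `` {v})" if "v \<in> thicken E r A" for v
    using that thicken_subset[OF assms(1,4), of r] assms(2) by (auto simp: bounded_degree_def)
  ultimately show ?case using Suc by (simp add: thicken_Suc)
qed (use assms in auto)

lemma card_thicken_le:
  assumes "simple_graph V E" "bounded_degree V E"
  shows "\<exists>B>0. \<forall>A. finite A \<and> A \<subseteq> V \<longrightarrow> card (thicken E r A) \<le> B * card A"
proof -
  obtain D where D: "\<And>v. v \<in> V \<Longrightarrow> card (E `` {v}) \<le> D"
    using assms(2) by (auto simp: bounded_degree_def)
  have "card (thicken E r A) \<le> Suc D ^ r * card A" if A: "finite A" "A \<subseteq> V" for A
  proof (induction r)
    case (Suc r)
    let ?N = "thicken E r A"
    have N: "finite ?N" "?N \<subseteq> V"
      using finite_thicken[OF assms A] thicken_subset[OF assms(1) A(2)] by auto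
    have "E `` ?N = (\<Union>v\<in>?N. E `` {v})" by blast
    then have "card (E `` ?N) \<le> (\<Sum>v\<in>?N. card (E `` {v}))"
      using card_UN_le[OF N(1)] by metis
    also have "\<dots> \<le> (\<Sum>v\<in>?N. D)" using D N by (intro sum_mono) auto
    finally have "card (E `` ?N) \<le> D * card ?N" by (simp add: mult.commute)
    then have "card (thicken E (Suc r) A) \<le> Suc D * card ?N"
      using card_Un_le[of ?N "E `` ?N"] by (simp add: thicken_Suc)
    also have "\<dots> \<le> Suc D * (Suc D ^ r * card A)" using Suc by (rule mult_le_mono2)
    finally show ?case by (simp only: power_Suc mult.assoc)
  qed simp
  then show ?thesis by (intro exI[of _ "Suc D ^ r"]) auto
qed

text \<open>
  With \<open>a r = card (thicken E r A)\<close>, boundaries of thickenings have size \<open>a (Suc r) - a r\<close>.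
\<close>

lemma vertex_boundary_thicken:
  assumes "simple_graph V E"
  shows "vertex_boundary V E (thicken E r A) = thicken E (Suc r) A - thicken E r A"
  using assms by (auto simp: vertex_boundary_def thicken_Suc simple_graph_def)

lemma path_dist_le_of_thicken:
  assumes "y \<in> thicken E r {x}"
  shows "path_dist E x y \<le> real r"
proof -
  have "\<exists>k\<le>r. (x, y) \<in> E ^^ k"
    using assms
  proof (induction r arbitrary: y)
    case (Suc r)
    then consider "y \<in> thicken E r {x}" | z where "z \<in> thicken E r {x}" "(z, y) \<in> E"
      by (auto simp: thicken_Suc)
    then show ?case
    proof cases
      case 1
      then show ?thesis using Suc.IH le_SucI by blast
    next
      case 2
      then obtain k where "k \<le> r" "(x, z) \<in> E ^^ k" using Suc.IH by blast
      then show ?thesis using 2(2) by (intro exI[of _ "Suc k"]) auto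
    qed
  qed auto
  then obtain k where "k \<le> r" "(x, y) \<in> E ^^ k" by blast
  then have "(LEAST k. (x, y) \<in> E ^^ k) \<le> r" using Least_le order_trans by metis
  then show ?thesis by (simp add: path_dist_def)
qed

lemma thicken_of_path_dist_le:
  assumes "(x, y) \<in> E\<^sup>*" "path_dist E x y \<le> real r"
  shows "y \<in> thicken E r {x}"
proof -
  have walk: "z \<in> thicken E k {x}" if "(x, z) \<in> E ^^ k" for k z
    using that
  proof (induction k arbitrary: z)
    case (Suc k)
    then obtain w where "(x, w) \<in> E ^^ k" "(w, z) \<in> E" by auto
    then show ?case using Suc.IH[of w] by (auto simp: thicken_Suc)
  qed simp
  let ?k = "LEAST k. (x, y) \<in> E ^^ k"
  have "(x, y) \<in> E ^^ ?k" using assms(1) LeastI_ex[of "\<lambda>k. (x, y) \<in> E ^^ k"]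
    by (auto simp: rtrancl_is_UN_relpow)
  then have "y \<in> thicken E ?k {x}" by (rule walk)
  moreover have "?k \<le> r" using assms(2) by (simp add: path_dist_def)
  ultimately show ?thesis using thicken_mono_radius[of ?k r E "{x}"] by blast
qed

section \<open>A thin annulus\<close>

text \<open>
  One of the \<open>L\<close> increments is at most the average \<open>(b L - b 0) / L\<close>, and for large \<open>L\<close> this is
  small compared with the sum of the others. The number \<open>L\<close> depends on \<open>\<epsilon>\<close> only, which
  is what makes the final radius uniform.
\<close>

lemma thin_step:
  fixes \<epsilon> :: real
  assumes "\<epsilon> > 0"
  shows "\<exists>L. \<forall>b :: nat \<Rightarrow> real. mono b \<longrightarrow>
    (\<exists>j<L. b (Suc j) - b j \<le> \<epsilon> * ((b L - b (Suc j)) + (b j - b 0)))"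
proof -
  obtain L :: nat where L: "1 + 1 / \<epsilon> < real L" using reals_Archimedean2 by blast
  have "L > 0" using L assms by (cases L) (auto simp: field_simps)
  have L': "1 + \<epsilon> < \<epsilon> * L" using L assms by (simp add: field_simps)
  have "\<exists>j<L. b (Suc j) - b j \<le> \<epsilon> * ((b L - b (Suc j)) + (b j - b 0))"
    if "mono b" for b :: "nat \<Rightarrow> real"
  proof (rule ccontr)
    assume neg: "\<not> ?thesis"
    let ?T = "b L - b 0"
    have "?T \<ge> 0" using \<open>mono b\<close> by (simp add: monoD)
    have "\<epsilon> * ?T < (1 + \<epsilon>) * (b (Suc j) - b j)" if "j < L" for j
      using neg that by (force simp: algebra_simps)
    then have "(\<Sum>j<L. \<epsilon> * ?T) < (\<Sum>j<L. (1 + \<epsilon>) * (b (Suc j) - b j))"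
      using \<open>L > 0\<close> by (intro sum_strict_mono) auto
    also have "\<dots> = (1 + \<epsilon>) * ?T" by (simp add: sum_lessThan_telescope flip: sum_distrib_left)
    finally have "\<epsilon> * L * ?T < (1 + \<epsilon>) * ?T" by (simp add: mult_ac)
    then show False using mult_right_mono[OF less_imp_le[OF L'] \<open>?T \<ge> 0\<close>] by linarith
  qed
  then show ?thesis by blast
qed

text \<open>
  The numerical core, with \<open>a r = |N\<^sub>r A|\<close> and \<open>p r = |f\<^sup>-\<^sup>1 (N\<^sub>r A)|\<close>: the first hypothesis on
  \<open>a\<close> and \<open>p\<close> is the quasi-\<open>\<kappa>\<close>-to-one property of \<open>N\<^sub>r A\<close>, the second says that an annulus in \<open>Y\<close>
  forces points of \<open>X\<close> into the preimage of the annulus enlarged by \<open>K\<close> on both sides.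

  For the first inequality take \<open>r\<close> in the middle of a thin annulus of width \<open>2 * K\<close>. Then
  \<open>p R = p r + (p R - p r)\<close>, where \<open>p r\<close> is close to \<open>\<kappa> * a r\<close>, which accounts for the points
  inside the annulus, and \<open>p R - p r\<close> accounts for those outside. The second inequality is
  dual: in \<open>p 0 = p r - (p r - p 0)\<close> the subtracted term accounts for the points inside,
  and \<open>\<kappa> * a R - \<kappa> * a r\<close> for those outside.
\<close>

lemma uniform_radius:
  fixes \<kappa> C B :: real and K :: nat
  assumes "\<kappa> > 0" "C > 0" "B > 0" "K \<ge> 1"
  shows "\<exists>R. \<forall>a p :: nat \<Rightarrow> real. mono a \<longrightarrow>
      (\<forall>r. \<bar>\<kappa> * a r - p r\<bar> \<le> C * (a (Suc r) - a r)) \<longrightarrow>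
      (\<forall>r s. r + K \<le> s \<longrightarrow> a s - a (r + K) \<le> B * (p (s + K) - p r)) \<longrightarrow>
      \<kappa> * a 0 \<le> p R \<and> p 0 \<le> \<kappa> * a R"
proof -
  \<comment> \<open>Each point of \<open>Y\<close> on either side of the annulus contributes at least \<open>c\<close>.\<close>
  define c where "c = min \<kappa> (1 / B)"
  have c: "c > 0" "c \<le> \<kappa>" "c \<le> 1 / B" using assms by (auto simp: c_def)
  obtain L where L: "\<And>b :: nat \<Rightarrow> real. mono b \<Longrightarrow>
      \<exists>j<L. b (Suc j) - b j \<le> c / C * ((b L - b (Suc j)) + (b j - b 0))"
    using thin_step[of "c / C"] c assms by auto
  define R where "R = 2 * K * L + K"
  have "\<kappa> * a 0 \<le> p R \<and> p 0 \<le> \<kappa> * a R"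
    if a: "mono a"
      and dev: "\<And>r. \<bar>\<kappa> * a r - p r\<bar> \<le> C * (a (Suc r) - a r)"
      and dense: "\<And>r s. r + K \<le> s \<Longrightarrow> a s - a (r + K) \<le> B * (p (s + K) - p r)"
    for a p :: "nat \<Rightarrow> real"
  proof -
    have le: "a i \<le> a j" if "i \<le> j" for i j using a that by (rule monoD)
    have dense': "c * (a s - a (r + K)) \<le> p (s + K) - p r" if "r + K \<le> s" for r s
    proof -
      have "c * (a s - a (r + K)) \<le> 1 / B * (a s - a (r + K))"
        using c(3) le[OF that] by (intro mult_right_mono) auto
      also have "\<dots> \<le> p (s + K) - p r" using dense[OF that] assms by (simp add: field_simps)
      finally show ?thesis .
    qed
    have \<kappa>': "c * (a j - a i) \<le> \<kappa> * (a j - a i)" if "i \<le> j" for i j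
      using c(2) le[OF that] by (intro mult_right_mono) auto
    \<comment> \<open>The annuli start at radius \<open>q\<close>. The second inequality needs \<open>q = K\<close>, since the density
        estimate says nothing about points at distance at most \<open>K\<close> from \<open>A\<close>.\<close>
    have thin: "\<exists>j<L. C * (a (Suc (q + 2 * K * j + K)) - a (q + 2 * K * j + K)) \<le>
        c * (a (q + 2 * K * L) - a (q + 2 * K * j + 2 * K)) + c * (a (q + 2 * K * j) - a q)" for q
    proof -
      let ?b = "\<lambda>j. a (q + 2 * K * j)"
      have "mono ?b" by (intro monoI le) simp
      then obtain j where j: "j < L"
        "?b (Suc j) - ?b j \<le> c / C * ((?b L - ?b (Suc j)) + (?b j - ?b 0))"
        using L[of ?b] by blast
      have "a (Suc (q + 2 * K * j + K)) - a (q + 2 * K * j + K) \<le> ?b (Suc j) - ?b j"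
        using \<open>K \<ge> 1\<close> by (intro diff_mono le) auto
      then have "C * (a (Suc (q + 2 * K * j + K)) - a (q + 2 * K * j + K))
          \<le> C * (c / C * ((?b L - ?b (Suc j)) + (?b j - ?b 0)))"
        using j(2) \<open>C > 0\<close> by (intro mult_left_mono) auto
      also have "\<dots> = c * (?b L - ?b (Suc j)) + c * (?b j - ?b 0)"
        using \<open>C > 0\<close> by (simp add: algebra_simps)
      finally show ?thesis using j(1) by (intro exI[of _ j]) (simp add: algebra_simps)
    qed
    have "\<kappa> * a 0 \<le> p R"
    proof -
      obtain j where j: "j < L" "C * (a (Suc (2 * K * j + K)) - a (2 * K * j + K)) \<le>
          c * (a (2 * K * L) - a (2 * K * j + 2 * K)) + c * (a (2 * K * j) - a 0)"
        using thin[of 0] by auto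
      let ?i = "2 * K * j + K"
      have step: "2 * K * j + 2 * K \<le> 2 * K * L"
        using mult_le_mono2[of "Suc j" L "2 * K"] j(1) by simp
      have "c * (a (2 * K * L) - a (2 * K * j + 2 * K)) \<le> p R - p ?i"
        using dense'[of ?i "2 * K * L"] step by (simp add: R_def mult_2 add.assoc)
      moreover have "c * (a (2 * K * j) - a 0) \<le> \<kappa> * (a (2 * K * j) - a 0)"
        by (rule \<kappa>') simp
      moreover have "\<kappa> * a (2 * K * j) \<le> \<kappa> * a ?i"
        using assms(1) by (intro mult_left_mono le) auto
      ultimately show ?thesis using dev[of ?i] j(2) by (simp add: right_diff_distrib abs_le_iff)
    qed
    moreover have "p 0 \<le> \<kappa> * a R"
    proof -
      obtain j where j: "j < L" "C * (a (Suc (K + 2 * K * j + K)) - a (K + 2 * K * j + K)) \<le>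
          c * (a R - a (K + 2 * K * j + 2 * K)) + c * (a (K + 2 * K * j) - a K)"
        using thin[of K] by (auto simp: R_def add.commute)
      let ?i = "K + 2 * K * j + K"
      have step: "2 * K * j + 2 * K \<le> 2 * K * L"
        using mult_le_mono2[of "Suc j" L "2 * K"] j(1) by simp
      have "c * (a (K + 2 * K * j) - a K) \<le> p ?i - p 0"
        using dense'[of 0 "K + 2 * K * j"] by simp
      moreover have "c * (a R - a (K + 2 * K * j + 2 * K)) \<le> \<kappa> * (a R - a (K + 2 * K * j + 2 * K))"
        using step by (intro \<kappa>') (simp add: R_def)
      moreover have "\<kappa> * a ?i \<le> \<kappa> * a (K + 2 * K * j + 2 * K)"
        using assms(1) by (intro mult_left_mono le) auto
      ultimately show ?thesis using dev[of ?i] j(2) by (simp add: right_diff_distrib abs_le_iff)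
    qed
    ultimately show ?thesis ..
  qed
  then show ?thesis by blast
qed

section \<open>Matching fibres to points\<close>

text \<open>
  Each point of \<open>S\<close> is within distance \<open>K\<close> of the image of a point of \<open>f -` T \<inter> X\<close>, and one image
  point serves at most \<open>B\<close> points of \<open>S\<close>.
\<close>

lemma card_le_preimage_thicken:
  assumes Y: "simple_graph Y E"
    and B: "\<And>A. finite A \<Longrightarrow> A \<subseteq> Y \<Longrightarrow> card (thicken E K A) \<le> B * card A"
    and fY: "f \<in> X \<rightarrow> Y"
    and dense: "\<And>y. y \<in> Y \<Longrightarrow> \<exists>x\<in>X. f x \<in> thicken E K {y}"
    and S: "S \<subseteq> Y" and T: "thicken E K S \<subseteq> T" and fin: "finite (f -` T \<inter> X)" "finite S"
    and bdd: "bounded_degree Y E"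
  shows "card S \<le> B * card (f -` T \<inter> X)"
proof -
  let ?F = "f ` (f -` T \<inter> X)"
  have F: "finite ?F" "?F \<subseteq> Y" using fin(1) fY by auto
  have "S \<subseteq> thicken E K ?F"
  proof
    fix y assume y: "y \<in> S"
    then obtain x where x: "x \<in> X" "f x \<in> thicken E K {y}" using dense S by blast
    then have "f x \<in> ?F" using y T thicken_mono[of "{y}" S E K] by auto
    moreover have "y \<in> thicken E K {f x}" using x(2) thicken_sym[OF Y] by metis
    ultimately show "y \<in> thicken E K ?F" using thicken_mono[of "{f x}" ?F E K] by blast
  qed
  then have "card S \<le> card (thicken E K ?F)"
    by (intro card_mono finite_thicken[OF Y bdd F])
  also have "\<dots> \<le> B * card ?F" by (rule B[OF F])
  also have "\<dots> \<le> B * card (f -` T \<inter> X)" by (intro mult_le_mono2 card_image_le fin)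
  finally show ?thesis .
qed

lemma thicken_annulus_subset:
  assumes "simple_graph V E"
  shows "thicken E K (thicken E s A - thicken E (r + K) A)
    \<subseteq> thicken E (s + K) A - thicken E r A"
proof
  fix z assume "z \<in> thicken E K (thicken E s A - thicken E (r + K) A)"
  then obtain y where y: "y \<in> thicken E s A" "y \<notin> thicken E (r + K) A" "z \<in> thicken E K {y}"
    by (auto simp: thicken_def)
  have "z \<in> thicken E (s + K) A"
    using y thicken_mono[of "{y}" "thicken E s A" E K] by (auto simp: thicken_add)
  moreover have "z \<notin> thicken E r A"
  proof
    assume "z \<in> thicken E r A"
    moreover have "y \<in> thicken E K {z}" using y(3) thicken_sym[OF assms] by metis
    ultimately have "y \<in> thicken E (r + K) A"
      using thicken_mono[of "{z}" "thicken E r A" E K] by (auto simp: thicken_add)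
    then show False using y(2) by blast
  qed
  ultimately show "z \<in> thicken E (s + K) A - thicken E r A" by blast
qed

text \<open>
  Hall's condition in both directions: a uniform thickening absorbs the boundary error
  of a quasi-\<open>\<kappa>\<close>-to-one map with coarsely dense image.
\<close>

lemma fibre_counts_balanced:
  fixes \<kappa> :: real
  assumes Y: "simple_graph Y E" "bounded_degree Y E"
    and \<kappa>: "\<kappa> > 0" "quasi_to_one \<kappa> X Y E f"
    and dense: "\<And>y. y \<in> Y \<Longrightarrow> \<exists>x\<in>X. f x \<in> thicken E K {y}"
  shows "\<exists>R. \<forall>A. finite A \<and> A \<subseteq> Y \<longrightarrow>
    \<kappa> * card A \<le> card (f -` thicken E R A \<inter> X) \<and> card (f -` A \<inter> X) \<le> \<kappa> * card (thicken E R A)"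
proof -
  obtain C where fY: "f \<in> X \<rightarrow> Y" and C: "C > 0"
    and finf: "\<And>A. finite A \<Longrightarrow> A \<subseteq> Y \<Longrightarrow> finite (f -` A \<inter> X)"
    and dev: "\<And>A. finite A \<Longrightarrow> A \<subseteq> Y \<Longrightarrow>
        \<bar>\<kappa> * real (card A) - real (card (f -` A \<inter> X))\<bar> \<le> C * real (card (vertex_boundary Y E A))"
    using \<kappa>(2) by (auto simp: quasi_to_one_def)
  \<comment> \<open>A density constant of at least 1, so that annuli of width \<open>2 * K'\<close> contain a boundary layer.\<close>
  define K' where "K' = Suc K"
  have dense': "\<exists>x\<in>X. f x \<in> thicken E K' {y}" if "y \<in> Y" for y
    using dense[OF that] by (auto simp: K'_def thicken_Suc)
  obtain B where B: "B > 0"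
    "\<And>A. finite A \<Longrightarrow> A \<subseteq> Y \<Longrightarrow> card (thicken E K' A) \<le> B * card A"
    using card_thicken_le[OF Y, of K'] by auto
  have "\<exists>R. \<forall>a p :: nat \<Rightarrow> real. mono a \<longrightarrow>
      (\<forall>r. \<bar>\<kappa> * a r - p r\<bar> \<le> C * (a (Suc r) - a r)) \<longrightarrow>
      (\<forall>r s. r + K' \<le> s \<longrightarrow> a s - a (r + K') \<le> real B * (p (s + K') - p r)) \<longrightarrow>
      \<kappa> * a 0 \<le> p R \<and> p 0 \<le> \<kappa> * a R"
    using \<kappa>(1) C B(1) by (intro uniform_radius) (auto simp: K'_def)
  then obtain R where R: "\<And>a p :: nat \<Rightarrow> real. \<lbrakk>mono a;
      \<forall>r. \<bar>\<kappa> * a r - p r\<bar> \<le> C * (a (Suc r) - a r);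
      \<forall>r s. r + K' \<le> s \<longrightarrow> a s - a (r + K') \<le> real B * (p (s + K') - p r)\<rbrakk> \<Longrightarrow>
      \<kappa> * a 0 \<le> p R \<and> p 0 \<le> \<kappa> * a R"
    by (elim exE) metis
  have "\<kappa> * card A \<le> card (f -` thicken E R A \<inter> X) \<and> card (f -` A \<inter> X) \<le> \<kappa> * card (thicken E R A)"
    if A: "finite A" "A \<subseteq> Y" for A
  proof -
    let ?N = "\<lambda>r. thicken E r A"
    let ?P = "\<lambda>r. f -` ?N r \<inter> X"
    have N: "finite (?N r)" "?N r \<subseteq> Y" for r
      using finite_thicken[OF Y A] thicken_subset[OF Y(1) A(2)] by auto
    have P: "finite (?P r)" for r by (rule finf[OF N])
    have NN: "?N r \<subseteq> ?N s" if "r \<le> s" for r s by (rule thicken_mono_radius[OF that])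
    have diff: "real (card (?N s - ?N r)) = real (card (?N s)) - real (card (?N r))"
      if "r \<le> s" for r s
      using NN[OF that] N by (simp add: card_Diff_subset card_mono of_nat_diff)
    have "\<kappa> * real (card (?N 0)) \<le> real (card (?P R)) \<and>
        real (card (?P 0)) \<le> \<kappa> * real (card (?N R))"
    proof (rule R; (intro allI impI)?)
      show "mono (\<lambda>r. real (card (?N r)))"
        by (rule monoI) (use N NN in \<open>simp add: card_mono\<close>)
    next
      fix r
      show "\<bar>\<kappa> * real (card (?N r)) - real (card (?P r))\<bar>
          \<le> C * (real (card (?N (Suc r))) - real (card (?N r)))"
        using dev[OF N, of r] diff[of r "Suc r"] by (simp add: vertex_boundary_thicken[OF Y(1)])
    next
      fix r s :: nat assume rs: "r + K' \<le> s"
      let ?S = "?N s - ?N (r + K')" and ?T = "?N (s + K') - ?N r"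
      have preT: "f -` ?T \<inter> X = ?P (s + K') - ?P r" by blast
      have "card ?S \<le> B * card (f -` ?T \<inter> X)"
        by (rule card_le_preimage_thicken[OF Y(1) B(2) fY dense' _
              thicken_annulus_subset[OF Y(1)] _ _ Y(2)])
          (use N P in \<open>auto simp: preT\<close>)
      then have "card ?S \<le> B * card (?P (s + K') - ?P r)" by (simp only: preT)
      moreover have "real (card (?P (s + K') - ?P r)) = real (card (?P (s + K'))) - real (card (?P r))"
      proof -
        have "?P r \<subseteq> ?P (s + K')" using NN[of r "s + K'"] rs by auto
        then show ?thesis using P by (simp add: card_Diff_subset card_mono of_nat_diff)
      qed
      ultimately show "real (card (?N s)) - real (card (?N (r + K')))
          \<le> real B * (real (card (?P (s + K'))) - real (card (?P r)))"
        using diff[OF rs] by (metis of_nat_le_iff of_nat_mult)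
    qed
    then show ?thesis by simp
  qed
  then show ?thesis by blast
qed

lemma card_le_fst_times:
  assumes "finite J" "J \<subseteq> U \<times> Z" "finite Z"
  shows "card J \<le> card (fst ` J) * card Z"
proof -
  have "J \<subseteq> fst ` J \<times> Z" using assms(2) by force
  then show ?thesis using card_mono[of "fst ` J \<times> Z" J] assms by (simp add: card_cartesian_product)
qed

theorem proposition1p1:
  fixes X :: "'a set" and E\<^sub>X :: "'a rel"
    and Y :: "'b set" and E\<^sub>Y :: "'b rel"
    and f :: "'a \<Rightarrow> 'b"
    and m n :: nat and \<kappa> :: real
  assumes "simple_graph X E\<^sub>X" and "connected_graph X E\<^sub>X" and "bounded_degree X E\<^sub>X"
    and "simple_graph Y E\<^sub>Y" and "connected_graph Y E\<^sub>Y" and "bounded_degree Y E\<^sub>Y"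
    and "m \<ge> 1" and "n \<ge> 1" and "\<kappa> = real m / real n"
    and "quasi_isometry X (path_dist E\<^sub>X) Y (path_dist E\<^sub>Y) f"
    and "quasi_to_one \<kappa> X Y E\<^sub>Y f"
  shows "\<exists>g :: 'a \<times> int \<Rightarrow> 'b.
           g ` (X \<times> carrier (integer_mod_group n)) = Y \<and>
           (\<forall>y\<in>Y. card (g -` {y} \<inter> X \<times> carrier (integer_mod_group n)) = m) \<and>
           bdd_above ((\<lambda>x. path_dist E\<^sub>Y (f x) (g (x, 0))) ` X)"
proof -
  note Y = assms(4,6)
  have \<kappa>: "\<kappa> > 0" "real n * \<kappa> = real m" using assms(7-9) by auto
  have fY: "f \<in> X \<rightarrow> Y" using assms(10) by (simp add: quasi_isometry_def)
  obtain K0 where K0: "\<forall>y\<in>Y. \<exists>x\<in>X. path_dist E\<^sub>Y y (f x) \<le> K0"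
    using assms(10) unfolding quasi_isometry_def by blast
  obtain K :: nat where K: "K0 \<le> real K" using real_arch_simple by blast
  have dense: "\<exists>x\<in>X. f x \<in> thicken E\<^sub>Y K {y}" if y: "y \<in> Y" for y
  proof -
    obtain x where x: "x \<in> X" "path_dist E\<^sub>Y y (f x) \<le> real K" using bspec[OF K0 y] K by fastforce
    have "f x \<in> Y" using fY x(1) by blast
    then have "(y, f x) \<in> E\<^sub>Y\<^sup>*" using assms(5) y by (simp add: connected_graph_def)
    from thicken_of_path_dist_le[OF this x(2)] show ?thesis using x(1) by blast
  qed
  have finf: "finite (f -` A \<inter> X)" if "finite A" "A \<subseteq> Y" for A
    using assms(11) that by (auto simp: quasi_to_one_def)
  obtain R where R: "\<And>A. finite A \<Longrightarrow> A \<subseteq> Y \<Longrightarrow>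
      \<kappa> * card A \<le> card (f -` thicken E\<^sub>Y R A \<inter> X) \<and>
      card (f -` A \<inter> X) \<le> \<kappa> * card (thicken E\<^sub>Y R A)"
    using fibre_counts_balanced[OF Y \<kappa>(1) assms(11) dense] by blast
  have lower: "m * card A \<le> n * card (f -` thicken E\<^sub>Y R A \<inter> X)"
    and upper: "n * card (f -` A \<inter> X) \<le> m * card (thicken E\<^sub>Y R A)"
    if "finite A" "A \<subseteq> Y" for A
  proof -
    have "real n * (\<kappa> * card A) \<le> real n * card (f -` thicken E\<^sub>Y R A \<inter> X)"
      "real n * card (f -` A \<inter> X) \<le> real n * (\<kappa> * card (thicken E\<^sub>Y R A))"
      using R[OF that] by (auto intro: mult_left_mono)
    then have "real (m * card A) \<le> real (n * card (f -` thicken E\<^sub>Y R A \<inter> X))"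
      "real (n * card (f -` A \<inter> X)) \<le> real (m * card (thicken E\<^sub>Y R A))"
      by (simp_all add: \<kappa>(2) flip: mult.assoc)
    then show "m * card A \<le> n * card (f -` thicken E\<^sub>Y R A \<inter> X)"
      "n * card (f -` A \<inter> X) \<le> m * card (thicken E\<^sub>Y R A)" by (simp_all only: of_nat_le_iff)
  qed
  let ?Z = "carrier (integer_mod_group n)"
  have Z: "?Z = {0..<int n}" using assms(8) by (simp add: carrier_integer_mod_group)
  have Z': "finite ?Z" "card ?Z = n" "0 \<in> ?Z" using assms(8) by (auto simp: Z)
  \<comment> \<open>The second components \<open>i\<close> and \<open>j\<close> are free: an edge only says that \<open>f x\<close> is close to \<open>y\<close>.\<close>
  define G where "G = {(p, q). p \<in> X \<times> ?Z \<and> snd q < m \<and> fst q \<in> thicken E\<^sub>Y R {f (fst p)}}"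
  have G_iff: "(p, q) \<in> G \<longleftrightarrow> p \<in> X \<times> ?Z \<and> snd q < m \<and> fst q \<in> thicken E\<^sub>Y R {f (fst p)}"
    for p q by (simp add: G_def)
  have in_nbhd: "y \<in> thicken E\<^sub>Y R A \<longleftrightarrow> (\<exists>a\<in>A. y \<in> thicken E\<^sub>Y R {a})" for y A
    by (auto simp: thicken_def)
  have in_nbhd': "z \<in> thicken E\<^sub>Y R A \<longleftrightarrow> (\<exists>a\<in>A. a \<in> thicken E\<^sub>Y R {z})" for z A
    unfolding in_nbhd[of z A] using thicken_sym[OF Y(1), of z R] by simp
  have img: "G `` J = thicken E\<^sub>Y R (f ` fst ` J) \<times> {..<m}" if J: "J \<subseteq> X \<times> ?Z" for J
  proof (rule Set.set_eqI)
    fix q :: "'b \<times> nat"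
    have "q \<in> G `` J \<longleftrightarrow> (\<exists>p\<in>J. (p, q) \<in> G)" by blast
    also have "\<dots> \<longleftrightarrow> (\<exists>p\<in>J. snd q < m \<and> fst q \<in> thicken E\<^sub>Y R {f (fst p)})"
      using J unfolding G_iff by blast
    also have "\<dots> \<longleftrightarrow> q \<in> thicken E\<^sub>Y R (f ` fst ` J) \<times> {..<m}"
      unfolding mem_Times_iff in_nbhd[of "fst q" "f ` fst ` J"] by (simp add: conj_commute)
    finally show "q \<in> G `` J \<longleftrightarrow> q \<in> thicken E\<^sub>Y R (f ` fst ` J) \<times> {..<m}" .
  qed
  have cimg: "G\<inverse> `` J = (f -` thicken E\<^sub>Y R (fst ` J) \<inter> X) \<times> ?Z" if J: "J \<subseteq> Y \<times> {..<m}" for J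
  proof (rule Set.set_eqI)
    fix p :: "'a \<times> int"
    have "p \<in> G\<inverse> `` J \<longleftrightarrow> (\<exists>q\<in>J. (p, q) \<in> G)" by blast
    also have "\<dots> \<longleftrightarrow> (\<exists>q\<in>J. p \<in> X \<times> ?Z \<and> fst q \<in> thicken E\<^sub>Y R {f (fst p)})"
      unfolding G_iff
    proof (intro bex_cong refl)
      fix q assume "q \<in> J"
      then have "snd q < m" using subsetD[OF J] by (simp add: mem_Times_iff)
      then show "p \<in> X \<times> ?Z \<and> snd q < m \<and> fst q \<in> thicken E\<^sub>Y R {f (fst p)} \<longleftrightarrow>
          p \<in> X \<times> ?Z \<and> fst q \<in> thicken E\<^sub>Y R {f (fst p)}" by simp
    qed
    also have "\<dots> \<longleftrightarrow> p \<in> (f -` thicken E\<^sub>Y R (fst ` J) \<inter> X) \<times> ?Z"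
      unfolding mem_Times_iff Int_iff vimage_eq in_nbhd'[of "f (fst p)" "fst ` J"] by (simp add: conj_ac)
    finally show "p \<in> G\<inverse> `` J \<longleftrightarrow> p \<in> (f -` thicken E\<^sub>Y R (fst ` J) \<inter> X) \<times> ?Z" .
  qed
  have fXY: "f ` fst ` J \<subseteq> Y" if "J \<subseteq> X \<times> ?Z" for J using that fY by auto
  have "\<exists>h. bij_betw h (X \<times> ?Z) (Y \<times> {..<m}) \<and> (\<forall>p\<in>X \<times> ?Z. (p, h p) \<in> G)"
  proof (rule perfect_matching_locally_finite)
    show "G \<subseteq> (X \<times> ?Z) \<times> (Y \<times> {..<m})"
    proof
      fix e assume "e \<in> G"
      moreover obtain p q where e: "e = (p, q)" by (cases e)
      ultimately have pq: "p \<in> X \<times> ?Z" "snd q < m" "fst q \<in> thicken E\<^sub>Y R {f (fst p)}"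
        by (simp_all add: G_iff)
      then have "f (fst p) \<in> Y" using fY by auto
      then have "fst q \<in> Y" using thicken_subset[OF Y(1), of "{f (fst p)}" R] pq(3) by blast
      then show "e \<in> (X \<times> ?Z) \<times> (Y \<times> {..<m})" using pq by (simp add: e mem_Times_iff)
    qed
  next
    fix p assume "p \<in> X \<times> ?Z"
    then have p: "{p} \<subseteq> X \<times> ?Z" by blast
    show "finite (G `` {p})"
      unfolding img[OF p] using finite_thicken[OF Y _ fXY[OF p]] by simp
  next
    fix q assume "q \<in> Y \<times> {..<m}"
    then have q: "{q} \<subseteq> Y \<times> {..<m}" by blast
    have "fst ` {q} \<subseteq> Y" "finite (fst ` {q})" using q by auto
    then show "finite (G\<inverse> `` {q})"
      unfolding cimg[OF q] using Z'(1)
      by (intro finite_cartesian_product finf finite_thicken[OF Y] thicken_subset[OF Y(1)])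
  next
    fix J assume J: "finite J" "J \<subseteq> X \<times> ?Z"
    let ?A = "f ` fst ` J"
    have A: "finite ?A" "?A \<subseteq> Y" using J(1) fXY[OF J(2)] by auto
    have "card J \<le> card (fst ` J) * n" using card_le_fst_times[OF J Z'(1)] Z'(2) by simp
    also have "\<dots> \<le> card (f -` ?A \<inter> X) * n"
      using J(2) finf[OF A] by (intro mult_le_mono1 card_mono) auto
    also have "\<dots> \<le> card (G `` J)"
      using upper[OF A] by (simp add: img[OF J(2)] card_cartesian_product mult.commute)
    finally show "card J \<le> card (G `` J)" .
  next
    fix J assume J: "finite J" "J \<subseteq> Y \<times> {..<m}"
    have A: "finite (fst ` J)" "fst ` J \<subseteq> Y" using J by auto
    have "card J \<le> card (fst ` J) * m" using card_le_fst_times[OF J] by simp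
    also have "\<dots> \<le> card (G\<inverse> `` J)"
      using lower[OF A] Z'(2) by (simp add: cimg[OF J(2)] card_cartesian_product mult.commute)
    finally show "card J \<le> card (G\<inverse> `` J)" .
  qed
  then obtain h where h: "bij_betw h (X \<times> ?Z) (Y \<times> {..<m})"
    and hG: "\<And>p. p \<in> X \<times> ?Z \<Longrightarrow> (p, h p) \<in> G" by blast
  define g where "g = fst \<circ> h"
  have "g ` (X \<times> ?Z) = fst ` (Y \<times> {..<m})"
    using h by (simp add: g_def bij_betw_def flip: image_image)
  also have "\<dots> = Y" using assms(7) by (auto simp: fst_image_times lessThan_empty_iff)
  finally have surj: "g ` (X \<times> ?Z) = Y" .
  have "card (g -` {y} \<inter> X \<times> ?Z) = m" if y: "y \<in> Y" for y
  proof -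
    have "h ` (g -` {y} \<inter> X \<times> ?Z) = {y} \<times> {..<m}"
    proof -
      have "h ` (g -` {y} \<inter> X \<times> ?Z) = h ` (X \<times> ?Z) \<inter> fst -` {y}" by (auto simp: g_def)
      also have "\<dots> = {y} \<times> {..<m}" using h y by (auto simp: bij_betw_def)
      finally show ?thesis .
    qed
    moreover have "inj_on h (g -` {y} \<inter> X \<times> ?Z)"
      using h by (auto simp: bij_betw_def intro: inj_on_subset)
    ultimately have "card (g -` {y} \<inter> X \<times> ?Z) = card ({y} \<times> {..<m})" by (metis card_image)
    then show ?thesis by simp
  qed
  moreover have "path_dist E\<^sub>Y (f x) (g (x, 0)) \<le> real R" if "x \<in> X" for x
  proof (rule path_dist_le_of_thicken)
    show "g (x, 0) \<in> thicken E\<^sub>Y R {f x}"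
      using hG[of "(x, 0)"] that Z'(3) by (simp add: G_iff g_def)
  qed
  then have "bdd_above ((\<lambda>x. path_dist E\<^sub>Y (f x) (g (x, 0))) ` X)" by (intro bdd_aboveI2)
  ultimately show ?thesis using surj by blast
qed

end
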